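(* For each integer $n\ge 1$, $\mu(n)=\mu^-(n)-1$, where $\mu(n)$ is the $n$th mediation number and $\mu^-(n)$ is the minimum of $\mathrm{mcard}(\mathcal{F})$ over all mediated families $\mathcal{F}$ on $[n]$.
   Context: Digraphs are finite, without loops or parallel arcs (both arcs $xy$ and $yx$ may be present). For a digraph $D$ and a vertex $x$, let $N^-(x)=\{y: yx\in A(D)\}$ and $N^-[x]=\{x\}\cup N^-(x)$; $\Delta^-(D)$ is the maximum of $|N^-(x)|$ over vertices $x$. A digraph $D$ is mediated if for every pair $x,y$ of distinct vertices there is a vertex $z$ (possibly $z=x$ or $z=y$) such that $x,y\in N^-[z]$. The $n$th mediation number $\mu(n)$ is the minimum of $\Delta^-(D)$ over all mediated digraphs $D$ on $n$ vertices. Let $[n]=\{1,2,\ldots,n\}$. A family $\mathcal{F}=\{X_1,X_2,\ldots,X_m\}$ of subsets (blocks) of a finite set $X$ is understood as an indexed family (repeated blocks are allowed). An $m$-tuple $(x_1,\ldots,x_m)$ is a system of distinct representatives (SDR) of $\mathcal{F}$ if the $x_i$ are pairwise distinct and $x_i\in X_i$ for each $i$. The family $\mathcal{F}$ is symmetric if $m=|X|$; it is 2-covering if for each pair $j,k$ of distinct points of $X$ there is $i\in\{1,\ldots,m\}$ with $\{j,k\}\subseteq X_i$. A family is mediated if it is symmetric, 2-covering and has an SDR. $\mathrm{mcard}(\mathcal{F})$ is the maximum cardinality of a block in $\mathcal{F}$. *)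

theory Defs
  imports "Graph_Theory.Pair_Digraph"
begin

section \<open>Mediated digraphs\<close>

text \<open>
  The digraphs are those of the locale \<^locale>\<open>pair_digraph\<close>: finite and loop-free, with a set of
  ordered pairs as arcs (hence no parallel arcs), where \<open>(x, y)\<close> is the arc from \<open>x\<close> to \<open>y\<close>.
\<close>

definition in_nbrs :: "'a pair_pre_digraph \<Rightarrow> 'a \<Rightarrow> 'a set" where
  "in_nbrs D x = {y. (y, x) \<in> parcs D}"

definition closed_in_nbrs :: "'a pair_pre_digraph \<Rightarrow> 'a \<Rightarrow> 'a set" where
  "closed_in_nbrs D x = insert x (in_nbrs D x)"

definition max_in_degree :: "'a pair_pre_digraph \<Rightarrow> nat" where
  "max_in_degree D = Max ((\<lambda>x. card (in_nbrs D x)) ` pverts D)"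

definition mediated_digraph :: "'a pair_pre_digraph \<Rightarrow> bool" where
  "mediated_digraph D \<longleftrightarrow> pair_digraph D \<and>
     (\<forall>x \<in> pverts D. \<forall>y \<in> pverts D. x \<noteq> y \<longrightarrow>
        (\<exists>z \<in> pverts D. {x, y} \<subseteq> closed_in_nbrs D z))"

text \<open>
  The minimum ranges over digraphs whose vertices are natural numbers. The lemma
  \<open>mediation_number_le\<close> below shows that this is no restriction.
\<close>

definition mediation_number :: "nat \<Rightarrow> nat" where
  "mediation_number n =
     (LEAST d. \<exists>D :: nat pair_pre_digraph.
        mediated_digraph D \<and> card (pverts D) = n \<and> d = max_in_degree D)"

lemma mediation_number_le:
  fixes D :: "'a pair_pre_digraph"
  assumes "mediated_digraph D"
  shows "mediation_number (card (pverts D)) \<le> max_in_degree D"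
proof -
  interpret pair_digraph D
    using assms by (simp add: mediated_digraph_def)
  obtain f :: "'a \<Rightarrow> nat" where f: "inj_on f (pverts D)"
    using finite_imp_inj_to_nat_seg[of "pverts D"] by auto
  define E where "E = \<lparr>pverts = f ` pverts D, parcs = map_prod f f ` parcs D\<rparr>"
  have arcs: "x \<in> pverts D \<and> y \<in> pverts D \<and> x \<noteq> y" if "(x, y) \<in> parcs D" for x y
    using that in_arcsD1 in_arcsD2 no_loops' by blast
  have pverts_E: "pverts E = f ` pverts D"
    by (simp add: E_def)
  have eqD: "a = b" if "f a = f b" "a \<in> pverts D" "b \<in> pverts D" for a b
    using f that by (auto dest: inj_onD)
  have nbrs: "in_nbrs E (f x) = f ` in_nbrs D x" if x: "x \<in> pverts D" for x
  proof (intro equalityI subsetI)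
    fix u assume "u \<in> in_nbrs E (f x)"
    then obtain a b where "(a, b) \<in> parcs D" "u = f a" "f x = f b"
      by (auto simp: E_def in_nbrs_def)
    moreover from this have "b = x"
      using eqD[of x b] x arcs by auto
    ultimately show "u \<in> f ` in_nbrs D x"
      by (auto simp: in_nbrs_def)
  qed (force simp: E_def in_nbrs_def)
  have "pair_digraph E"
    using pair_finite_verts pair_finite_arcs
    by unfold_locales (auto simp: E_def dest: arcs, (metis arcs eqD)?)
  moreover have "\<exists>z \<in> pverts E. {u, v} \<subseteq> closed_in_nbrs E z"
    if uv: "u \<in> pverts E" "v \<in> pverts E" "u \<noteq> v" for u v
  proof -
    obtain x y where xy: "x \<in> pverts D" "y \<in> pverts D" "u = f x" "v = f y" "x \<noteq> y"
      using uv by (auto simp: E_def)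
    then obtain z where "z \<in> pverts D" "{x, y} \<subseteq> closed_in_nbrs D z"
      using assms unfolding mediated_digraph_def by blast
    then have "f z \<in> pverts E" "{u, v} \<subseteq> closed_in_nbrs E (f z)"
      using xy by (auto simp: closed_in_nbrs_def nbrs pverts_E)
    then show ?thesis by blast
  qed
  ultimately have "mediated_digraph E"
    by (simp add: mediated_digraph_def)
  moreover have "card (pverts E) = card (pverts D)"
    using f by (simp add: E_def card_image)
  moreover have "max_in_degree E = max_in_degree D"
  proof -
    have "card (in_nbrs E (f x)) = card (in_nbrs D x)" if "x \<in> pverts D" for x
    proof -
      have "in_nbrs D x \<subseteq> pverts D" using arcs by (auto simp: in_nbrs_def)
      then show ?thesis using nbrs[OF that] f by (metis card_image inj_on_subset)
    qed
    then have "(\<lambda>x. card (in_nbrs E x)) ` pverts E = (\<lambda>x. card (in_nbrs D x)) ` pverts D"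
      by (force simp: E_def)
    then show ?thesis by (simp add: max_in_degree_def)
  qed
  ultimately show ?thesis
    unfolding mediation_number_def by (metis (mono_tags, lifting) Least_le)
qed


section \<open>Mediated families\<close>

text \<open>
  An indexed family \<open>F 1, \<dots>, F m\<close> of subsets of \<open>X\<close> is given by the ground set \<open>X\<close>, the number
  \<open>m\<close> and the function \<open>F\<close>, whose values outside \<open>{1..m}\<close> are irrelevant.
\<close>

definition block_family :: "'a set \<Rightarrow> nat \<Rightarrow> (nat \<Rightarrow> 'a set) \<Rightarrow> bool" where
  "block_family X m F \<longleftrightarrow> finite X \<and> (\<forall>i \<in> {1..m}. F i \<subseteq> X)"

definition is_SDR :: "nat \<Rightarrow> (nat \<Rightarrow> 'a set) \<Rightarrow> (nat \<Rightarrow> 'a) \<Rightarrow> bool" where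
  "is_SDR m F x \<longleftrightarrow> inj_on x {1..m} \<and> (\<forall>i \<in> {1..m}. x i \<in> F i)"

definition symmetric_family :: "'a set \<Rightarrow> nat \<Rightarrow> (nat \<Rightarrow> 'a set) \<Rightarrow> bool" where
  "symmetric_family X m F \<longleftrightarrow> block_family X m F \<and> m = card X"

definition two_covering :: "'a set \<Rightarrow> nat \<Rightarrow> (nat \<Rightarrow> 'a set) \<Rightarrow> bool" where
  "two_covering X m F \<longleftrightarrow> block_family X m F \<and>
     (\<forall>j \<in> X. \<forall>k \<in> X. j \<noteq> k \<longrightarrow> (\<exists>i \<in> {1..m}. {j, k} \<subseteq> F i))"

definition mediated_family :: "'a set \<Rightarrow> nat \<Rightarrow> (nat \<Rightarrow> 'a set) \<Rightarrow> bool" where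
  "mediated_family X m F \<longleftrightarrow>
     symmetric_family X m F \<and> two_covering X m F \<and> (\<exists>x. is_SDR m F x)"

definition mcard :: "nat \<Rightarrow> (nat \<Rightarrow> 'a set) \<Rightarrow> nat" where
  "mcard m F = Max ((\<lambda>i. card (F i)) ` {1..m})"

definition family_mediation_number :: "nat \<Rightarrow> nat" where
  "family_mediation_number n =
     (LEAST d. \<exists>m F. mediated_family {1..n} m F \<and> d = mcard m F)"

end

theory Submission
  imports Defs
begin

text \<open>
  The vertices of a mediated digraph index the family of its closed in-neighbourhoods, which is
  2-covering and has the vertices themselves as an SDR. Conversely, an SDR of a mediated family on
  \<open>X\<close> is a bijection from the indices to \<open>X\<close>, and so makes each block the closed
  in-neighbourhood of its representative. Both constructions turn in-degree \<open>d\<close> into block size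
  \<open>d + 1\<close> and back.
\<close>

lemma Max_image_Suc:
  assumes "finite A" "A \<noteq> {}"
  shows "Max ((\<lambda>i. Suc (f i)) ` A) = Suc (Max (f ` A))"
  using mono_Max_commute[of Suc "f ` A"] assms by (simp add: mono_Suc image_image)

text \<open>Shared by both constructions: the bijection \<open>x\<close> turns the maximum over
  indices into one over vertices, and \<open>1 \<le> m\<close> keeps both maxima away from the empty
  set.\<close>

lemma mcard_eq_Suc_max_in_degree:
  assumes "bij_betw x {1..m} (pverts D)" "1 \<le> m"
    and "\<And>i. i \<in> {1..m} \<Longrightarrow> card (F i) = Suc (card (in_nbrs D (x i)))"
  shows "mcard m F = Suc (max_in_degree D)"
proof -
  have "(\<lambda>i. card (F i)) ` {1..m} = (\<lambda>i. Suc (card (in_nbrs D (x i)))) ` {1..m}"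
    using assms(3) by (rule image_cong[OF refl])
  moreover have "(\<lambda>i. card (in_nbrs D (x i))) ` {1..m} = (\<lambda>v. card (in_nbrs D v)) ` pverts D"
    using bij_betw_imp_surj_on[OF assms(1)] by (metis image_image)
  ultimately show ?thesis
    using assms(2) by (simp add: mcard_def max_in_degree_def Max_image_Suc)
qed

text \<open>The absence of loops keeps \<open>v\<close> out of \<open>in_nbrs D v\<close>, so
  inserting it adds exactly one element to a finite set.\<close>

lemma card_closed_in_nbrs:
  assumes "pair_digraph D"
  shows "card (closed_in_nbrs D v) = Suc (card (in_nbrs D v))"
proof -
  interpret pair_digraph D by fact
  have "in_nbrs D v \<subseteq> pverts D" "v \<notin> in_nbrs D v"
    using in_arcsD1 no_loops' by (auto simp: in_nbrs_def)
  then show ?thesis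
    using finite_subset[OF _ pair_finite_verts] by (auto simp: closed_in_nbrs_def)
qed

text \<open>Symmetry makes \<open>m\<close> equal to \<open>card X\<close>, so an injection of the
  indices into the finite set \<open>X\<close> is onto.\<close>

lemma SDR_bij_betw:
  assumes "symmetric_family X m F" "is_SDR m F x"
  shows "bij_betw x {1..m} X"
proof -
  have "inj_on x {1..m}" "x ` {1..m} \<subseteq> X" "finite X" "card X = m"
    using assms by (auto simp: symmetric_family_def block_family_def is_SDR_def)
  then show ?thesis
    by (simp add: bij_betw_def card_image card_subset_eq)
qed

lemma mediated_digraph_of_family:
  assumes F: "mediated_family X m F" and m: "1 \<le> m"
  obtains D where "mediated_digraph D" "pverts D = X" "mcard m F = Suc (max_in_degree D)"
proof -
  obtain x where x: "is_SDR m F x"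
    using F by (auto simp: mediated_family_def)
  have bij: "bij_betw x {1..m} X"
    using F x SDR_bij_betw by (auto simp: mediated_family_def)
  have fin: "finite X" and sub: "\<And>i. i \<in> {1..m} \<Longrightarrow> F i \<subseteq> X"
    using F by (auto simp: mediated_family_def symmetric_family_def block_family_def)
  \<comment> \<open>Block \<open>F i\<close> supplies the arcs into its representative
    \<open>x i\<close>; removing \<open>x i\<close> itself avoids a loop.\<close>
  define D where "D = \<lparr>pverts = X, parcs = {(y, x i) |i y. i \<in> {1..m} \<and> y \<in> F i - {x i}}\<rparr>"
  have verts: "pverts D = X" by (simp add: D_def)
  have arcs: "parcs D \<subseteq> X \<times> X"
    using sub bij_betwE[OF bij] by (auto simp: D_def)
  have D: "pair_digraph D"
    using arcs fin finite_subset[OF arcs]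
    by unfold_locales (auto simp: verts, auto simp: D_def)
  \<comment> \<open>By injectivity of \<open>x\<close>, no other block contributes arcs into
    \<open>x i\<close>, and the removed point \<open>x i\<close> returns as the centre of the closed
    neighbourhood.\<close>
  have closed: "closed_in_nbrs D (x i) = F i" if i: "i \<in> {1..m}" for i
    using i x by (auto simp: closed_in_nbrs_def in_nbrs_def D_def is_SDR_def dest: inj_onD)
  have "\<exists>z \<in> X. {u, v} \<subseteq> closed_in_nbrs D z" if uv: "u \<in> X" "v \<in> X" "u \<noteq> v" for u v
  proof -
    obtain i where "i \<in> {1..m}" "{u, v} \<subseteq> F i"
      using F uv unfolding mediated_family_def two_covering_def by blast
    then show ?thesis
      using closed bij_betwE[OF bij] by metis
  qed
  then have "mediated_digraph D"
    using D by (simp add: mediated_digraph_def verts)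
  moreover have "mcard m F = Suc (max_in_degree D)"
    using bij m by (intro mcard_eq_Suc_max_in_degree[of x])
      (simp_all add: verts flip: closed card_closed_in_nbrs[OF D])
  ultimately show thesis
    using that verts by blast
qed

lemma mediated_family_of_digraph:
  assumes D: "mediated_digraph D" and n: "card (pverts D) = n" "1 \<le> n"
  obtains F where "mediated_family {1..n} n F" "mcard n F = Suc (max_in_degree D)"
proof -
  interpret pair_digraph D
    using D by (simp add: mediated_digraph_def)
  obtain x where bij: "bij_betw x {1..n} (pverts D)"
    using ex_bij_betw_nat_finite_1[OF pair_finite_verts] n by auto
  \<comment> \<open>The numbering \<open>x\<close> labels blocks and points alike, so the vertices
    as their own representatives become the SDR \<open>id\<close>.\<close>
  define F where "F i = {j \<in> {1..n}. x j \<in> closed_in_nbrs D (x i)}" for i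
  have "is_SDR n F id"
    by (auto simp: is_SDR_def F_def closed_in_nbrs_def)
  moreover have "\<exists>i \<in> {1..n}. {j, k} \<subseteq> F i" if jk: "j \<in> {1..n}" "k \<in> {1..n}" "j \<noteq> k" for j k
  proof -
    have "x j \<in> pverts D" "x k \<in> pverts D" "x j \<noteq> x k"
      using jk bij by (auto simp: bij_betw_def dest: inj_onD)
    then obtain z where z: "z \<in> pverts D" "{x j, x k} \<subseteq> closed_in_nbrs D z"
      using D unfolding mediated_digraph_def by blast
    then obtain i where "i \<in> {1..n}" "z = x i"
      using bij_betw_imp_surj_on[OF bij] by blast
    then show ?thesis
      using z jk by (auto simp: F_def)
  qed
  moreover have "block_family {1..n} n F"
    by (auto simp: block_family_def F_def)
  ultimately have "mediated_family {1..n} n F"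
    unfolding mediated_family_def symmetric_family_def two_covering_def by auto
  moreover have "card (F i) = Suc (card (in_nbrs D (x i)))" if i: "i \<in> {1..n}" for i
  proof -
    \<comment> \<open>Pulling back along \<open>x\<close> loses no point, since every in-neighbour
      is a vertex and hence a value of \<open>x\<close>.\<close>
    have "closed_in_nbrs D (x i) \<subseteq> x ` {1..n}"
      using bij_betw_imp_surj_on[OF bij] i in_arcsD1 by (auto simp: closed_in_nbrs_def in_nbrs_def)
    then have "x ` F i = closed_in_nbrs D (x i)"
      by (auto simp: F_def)
    moreover have "inj_on x (F i)"
      using bij by (auto simp: F_def bij_betw_def intro: inj_on_subset)
    ultimately show ?thesis
      using card_closed_in_nbrs[OF pair_digraph_axioms] by (metis card_image)
  qed
  then have "mcard n F = Suc (max_in_degree D)"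
    using bij n by (intro mcard_eq_Suc_max_in_degree)
  ultimately show thesis
    using that by blast
qed

text \<open>Ensures that the minimum defining \<open>family_mediation_number\<close> ranges over a
  nonempty set and so is attained.\<close>

lemma mediated_family_const:
  "mediated_family {1..n} n (\<lambda>i. {1..n})"
proof -
  have "is_SDR n (\<lambda>i. {1..n}) id"
    by (simp add: is_SDR_def)
  then show ?thesis
    by (auto simp: mediated_family_def symmetric_family_def two_covering_def block_family_def)
qed

theorem proposition4p1:
  fixes n :: nat
  assumes "n \<ge> 1"
  shows "int (mediation_number n) = int (family_mediation_number n) - 1"
proof -
  have "\<exists>d m F. mediated_family {1..n} m F \<and> d = mcard m F"
    using mediated_family_const by blast
  from LeastI_ex[OF this] obtain m F where
    F: "mediated_family {1..n} m F" "family_mediation_number n = mcard m F"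
    unfolding family_mediation_number_def by blast
  have "1 \<le> m"
    using F(1) assms by (simp add: mediated_family_def symmetric_family_def)
  then obtain D where D: "mediated_digraph D" "pverts D = {1..n}" "mcard m F = Suc (max_in_degree D)"
    using mediated_digraph_of_family F(1) by metis
  have le: "Suc (mediation_number n) \<le> family_mediation_number n"
    using mediation_number_le[OF D(1)] D F(2) by simp
  \<comment> \<open>The digraph built from an optimal family also shows that the minimum defining
    \<open>mediation_number\<close> is attained.\<close>
  have "\<exists>d D :: nat pair_pre_digraph.
      mediated_digraph D \<and> card (pverts D) = n \<and> d = max_in_degree D"
    using D by auto
  from LeastI_ex[OF this] obtain E :: "nat pair_pre_digraph" where
    E: "mediated_digraph E" "card (pverts E) = n" "mediation_number n = max_in_degree E"
    unfolding mediation_number_def by blast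
  then obtain G where "mediated_family {1..n} n G" "mcard n G = Suc (mediation_number n)"
    using mediated_family_of_digraph assms by metis
  then have "family_mediation_number n \<le> Suc (mediation_number n)"
    unfolding family_mediation_number_def by (metis (mono_tags, lifting) Least_le)
  with le show ?thesis
    by simp
qed

end
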